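(* Let $\mathbf{A}=[a_{jk}]$ be a fixed real $m\times n$ matrix, and let $\mathbf{X}=[X_{jk}]$ be a random $m\times n$ real matrix with independent entries for which $\mathbb{E}X_{jk}=a_{jk}$ for all $j,k$. Then \[ \mathbb{E}\|\mathbf{A}-\mathbf{X}\|_{\infty\to1}\le 2\left[\sum_{k}\Big(\sum_{j}\mathrm{Var}(X_{jk})\Big)^{1/2}+\sum_{j}\Big(\sum_{k}\mathrm{Var}(X_{jk})\Big)^{1/2}\right]. \]
   Context: For a real $m\times n$ matrix $\mathbf{B}$, $\|\mathbf{B}\|_{\infty\to1}=\max_{\mathbf{u}\ne\mathbf{0}}\|\mathbf{B}\mathbf{u}\|_1/\|\mathbf{u}\|_\infty$. $\mathrm{Var}(X)=\mathbb{E}(X-\mathbb{E}X)^2$, taking values in $[0,+\infty]$. The index $j$ runs over the $m$ rows and $k$ over the $n$ columns. *)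

theory Defs
  imports "HOL-Probability.Probability"
begin

definition norm1 :: "real ^ 'n \<Rightarrow> real" where
  "norm1 y = (\<Sum>i\<in>UNIV. \<bar>y $ i\<bar>)"

text \<open>
  The library's \<open>infnorm\<close> is the maximum norm on \<open>real ^ 'n\<close>. The supremum below is attained
  (lemma \<open>norm_inf_to_1_attained\<close>), so it is a maximum.
\<close>

definition norm_inf_to_1 :: "real ^ 'n ^ 'm \<Rightarrow> real" where
  "norm_inf_to_1 B = (SUP u\<in>{u. u \<noteq> 0}. norm1 (B *v u) / infnorm u)"

lemma norm_inf_to_1_attained:
  fixes B :: "real ^ 'n ^ 'm"
  obtains v where "v \<noteq> 0" "norm_inf_to_1 B = norm1 (B *v v) / infnorm v"
    "\<And>u. u \<noteq> 0 \<Longrightarrow> norm1 (B *v u) / infnorm u \<le> norm1 (B *v v) / infnorm v"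
proof -
  let ?f = "\<lambda>u. norm1 (B *v u) / infnorm u"
  have "continuous_on (sphere 0 1) ?f"
    unfolding norm1_def by (intro continuous_intros) (auto simp: infnorm_eq_0)
  moreover have "sphere (0 :: real ^ 'n) 1 \<noteq> {}"
    by simp
  ultimately obtain v where v: "v \<in> sphere 0 1" "\<And>u. u \<in> sphere 0 1 \<Longrightarrow> ?f u \<le> ?f v"
    using continuous_attains_sup[of "sphere 0 1" ?f] by auto
  have v0: "v \<noteq> 0"
    using v(1) by auto
  have le: "?f u \<le> ?f v" if "u \<noteq> 0" for u
  proof -
    have "norm1 (B *v (c *\<^sub>R u)) = \<bar>c\<bar> * norm1 (B *v u)" for c
      by (simp add: norm1_def matrix_vector_mult_scaleR abs_mult sum_distrib_left)
    then have "?f ((1 / norm u) *\<^sub>R u) = ?f u"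
      using that by (simp add: infnorm_mul)
    moreover have "(1 / norm u) *\<^sub>R u \<in> sphere 0 1"
      using that by simp
    ultimately show ?thesis
      using v(2) by metis
  qed
  have "norm_inf_to_1 B = ?f v"
    unfolding norm_inf_to_1_def by (rule cSup_eq_maximum) (use v0 le in auto)
  with v0 le that show thesis
    by blast
qed

text \<open>
  The library's \<open>variance\<close> is a Bochner integral, hence \<open>0\<close> when the second moment is infinite.
  Here such a variance is \<open>\<infinity>\<close>. The mean is only meaningful for integrable \<open>X\<close>.
\<close>

definition ext_variance :: "'a measure \<Rightarrow> ('a \<Rightarrow> real) \<Rightarrow> ennreal" where
  "ext_variance M X = (\<integral>\<^sup>+\<omega>. ennreal ((X \<omega> - integral\<^sup>L M X)\<^sup>2) \<partial>M)"

definition ennreal_sqrt :: "ennreal \<Rightarrow> ennreal" where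
  "ennreal_sqrt x = (if x = \<infinity> then \<infinity> else ennreal (sqrt (enn2real x)))"

end

theory Submission
  imports Defs
begin

text \<open>
  Put \<open>Z = A - X\<close>. Then \<open>norm_inf_to_1 Z\<close> is the maximum over sign vectors \<open>u\<close> of
  \<open>\<Sum>j. \<bar>\<Sum>k. u k * Z j k\<bar>\<close>. Subtracting the mean of each summand costs the row term, by
  \<open>E \<bar>Y\<bar> \<le> sqrt (E Y\<^sup>2)\<close>. The centred summands are then replaced one row at a time:
  conditionally on the other rows, \<open>\<bar>Y\<bar> - E \<bar>Y\<bar>\<close> inside the maximum may be exchanged for
  \<open>2 * s * Y\<close> with \<open>s\<close> one of the signs \<open>1\<close>, \<open>-1\<close>, which symmetrizes and contracts in a
  single step. When all rows are done, the maximum of \<open>2 * (\<Sum>k. u k * (\<Sum>j. s j * Z j k))\<close> is at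
  most \<open>2 * (\<Sum>k. \<bar>\<Sum>j. s j * Z j k\<bar>)\<close>, which gives the column term.
\<close>

section \<open>Symmetrization and contraction of the rows\<close>

text \<open>Let \<open>u\<close> and \<open>v\<close> attain the two maxima on the left. The sign of
  \<open>h u\<close> decides which maximum on the right dominates
  \<open>g u + \<bar>h u\<bar>\<close>; the other one dominates
  \<open>g v - \<bar>h v\<bar>\<close>, because \<open>- \<bar>h v\<bar>\<close> is at most both
  \<open>h v\<close> and \<open>- h v\<close>. This is the contraction step, in a form that needs no
  random signs.\<close>

lemma MAX_add_abs_MAX_diff_abs_le:
  fixes g h :: "'u \<Rightarrow> real"
  assumes U: "finite U" "U \<noteq> {}"
  shows "(MAX u\<in>U. g u + \<bar>h u\<bar>) + (MAX u\<in>U. g u - \<bar>h u\<bar>)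
    \<le> (MAX u\<in>U. g u + h u) + (MAX u\<in>U. g u - h u)"
proof -
  have att: "\<exists>u\<in>U. (MAX u\<in>U. f u) = f u" for f :: "'u \<Rightarrow> real"
    using Max_in[of "f ` U"] U by (auto simp: image_iff)
  obtain u where u: "u \<in> U" "(MAX u\<in>U. g u + \<bar>h u\<bar>) = g u + \<bar>h u\<bar>"
    using att[of "\<lambda>u. g u + \<bar>h u\<bar>"] by blast
  obtain v where v: "v \<in> U" "(MAX u\<in>U. g u - \<bar>h u\<bar>) = g v - \<bar>h v\<bar>"
    using att[of "\<lambda>u. g u - \<bar>h u\<bar>"] by blast
  have ge: "f w \<le> (MAX u\<in>U. f u)" if "w \<in> U" for w and f :: "'u \<Rightarrow> real"
    using U that by (intro Max_ge) auto
  show ?thesis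
    using ge[OF u(1), of "\<lambda>u. g u + h u"] ge[OF v(1), of "\<lambda>u. g u - h u"]
      ge[OF v(1), of "\<lambda>u. g u + h u"] ge[OF u(1), of "\<lambda>u. g u - h u"] u(2) v(2)
    by linarith
qed

text \<open>Instead of an independent copy, the constant
  \<open>expectation (\<lambda>z. \<bar>H u z\<bar>)\<close> is absorbed into the expectation of a
  second maximum, with the same \<open>z\<close>. Both maxima then sit under one integral, where the
  contraction inequality removes the absolute values pointwise.\<close>

lemma (in prob_space) expectation_MAX_centred_abs_le:
  fixes g :: "'u \<Rightarrow> real" and H :: "'u \<Rightarrow> 'a \<Rightarrow> real"
  assumes U: "finite U" "U \<noteq> {}"
    and H: "\<And>u. u \<in> U \<Longrightarrow> integrable M (H u)"
  shows "expectation (\<lambda>z. MAX u\<in>U. g u + (\<bar>H u z\<bar> - expectation (\<lambda>z. \<bar>H u z\<bar>)))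
    \<le> (expectation (\<lambda>z. MAX u\<in>U. g u + 2 * H u z)
      + expectation (\<lambda>z. MAX u\<in>U. g u - 2 * H u z)) / 2"
proof -
  have int: "integrable M (\<lambda>z. MAX u\<in>U. g u + 2 * H u z)"
    "integrable M (\<lambda>z. MAX u\<in>U. g u - 2 * H u z)"
    "integrable M (\<lambda>z. MAX u\<in>U. g u + 2 * \<bar>H u z\<bar>)"
    "integrable M (\<lambda>z. MAX u\<in>U. g u - 2 * \<bar>H u z\<bar>)"
    "integrable M (\<lambda>z. MAX u\<in>U. g u + (\<bar>H u z\<bar> - expectation (\<lambda>z. \<bar>H u z\<bar>)))"
    using U H by (auto intro!: integrable_MAX)
  let ?c = "expectation (\<lambda>z. MAX u\<in>U. g u - 2 * \<bar>H u z\<bar>)"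
  \<comment> \<open>Jensen's inequality for the maximum: the expected maximum dominates the
    expectation of each member.\<close>
  have low: "g u - 2 * expectation (\<lambda>z. \<bar>H u z\<bar>) \<le> ?c" if u: "u \<in> U" for u
  proof -
    have "expectation (\<lambda>z. g u - 2 * \<bar>H u z\<bar>) \<le> ?c"
      using U H u int by (intro integral_mono) auto
    then show ?thesis
      using H[OF u] by (simp add: prob_space)
  qed
  \<comment> \<open>Each member is split as \<open>(g u + 2 * \<bar>H u z\<bar>) / 2 + (g u - 2 *
    expectation (\<lambda>z. \<bar>H u z\<bar>)) / 2\<close>. Sharing \<open>g u\<close> between two
    halves is where the factor 2 in front of \<open>H\<close> comes from.\<close>
  have "(MAX u\<in>U. g u + (\<bar>H u z\<bar> - expectation (\<lambda>z. \<bar>H u z\<bar>)))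
      \<le> (MAX u\<in>U. g u + 2 * \<bar>H u z\<bar>) / 2 + ?c / 2" for z
  proof (rule Max.boundedI)
    fix x assume "x \<in> (\<lambda>u. g u + (\<bar>H u z\<bar> - expectation (\<lambda>z. \<bar>H u z\<bar>))) ` U"
    then obtain u where u: "u \<in> U" and x: "x = g u + (\<bar>H u z\<bar> - expectation (\<lambda>z. \<bar>H u z\<bar>))"
      by auto
    have "g u + 2 * \<bar>H u z\<bar> \<le> (MAX u\<in>U. g u + 2 * \<bar>H u z\<bar>)"
      using U u by (intro Max_ge) auto
    with low[OF u] x show "x \<le> (MAX u\<in>U. g u + 2 * \<bar>H u z\<bar>) / 2 + ?c / 2"
      by linarith
  qed (use U in auto)
  then have "expectation (\<lambda>z. MAX u\<in>U. g u + (\<bar>H u z\<bar> - expectation (\<lambda>z. \<bar>H u z\<bar>)))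
      \<le> expectation (\<lambda>z. (MAX u\<in>U. g u + 2 * \<bar>H u z\<bar>) / 2 + ?c / 2)"
    using int by (intro integral_mono) auto
  also have "\<dots> = expectation (\<lambda>z. (MAX u\<in>U. g u + 2 * \<bar>H u z\<bar>) + (MAX u\<in>U. g u - 2 * \<bar>H u z\<bar>)) / 2"
    using int by (simp add: prob_space add_divide_distrib)
  also have "expectation (\<lambda>z. (MAX u\<in>U. g u + 2 * \<bar>H u z\<bar>) + (MAX u\<in>U. g u - 2 * \<bar>H u z\<bar>))
      \<le> expectation (\<lambda>z. (MAX u\<in>U. g u + 2 * H u z) + (MAX u\<in>U. g u - 2 * H u z))"
  proof (rule integral_mono)
    show "(MAX u\<in>U. g u + 2 * \<bar>H u z\<bar>) + (MAX u\<in>U. g u - 2 * \<bar>H u z\<bar>)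
        \<le> (MAX u\<in>U. g u + 2 * H u z) + (MAX u\<in>U. g u - 2 * H u z)" for z
      using MAX_add_abs_MAX_diff_abs_le[OF U, of g "\<lambda>u. 2 * H u z"] by (simp add: abs_mult)
  qed (use int in auto)
  finally show ?thesis
    using int by simp
qed

text \<open>By independence the joint law of \<open>W\<close> and \<open>Z\<close> is the product of
  their laws. Fubini then allows \<open>W\<close> to be frozen at a value \<open>w\<close>, and the
  preceding lemma applies under the law of \<open>Z\<close> with \<open>G u w\<close> as the
  constant part.\<close>

lemma (in prob_space) expectation_MAX_centred_abs_le_indep:
  fixes G :: "'u \<Rightarrow> 's \<Rightarrow> real" and H :: "'u \<Rightarrow> 's \<Rightarrow> real"
  assumes U: "finite U" "U \<noteq> {}"
    and ind: "indep_var S W T Z"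
    and [measurable]: "\<And>u. G u \<in> borel_measurable S"
    and [measurable]: "\<And>u. H u \<in> borel_measurable T"
    and G: "\<And>u. u \<in> U \<Longrightarrow> integrable M (\<lambda>\<omega>. G u (W \<omega>))"
    and H: "\<And>u. u \<in> U \<Longrightarrow> integrable M (\<lambda>\<omega>. H u (Z \<omega>))"
  shows "expectation (\<lambda>\<omega>. MAX u\<in>U. G u (W \<omega>) + (\<bar>H u (Z \<omega>)\<bar> - expectation (\<lambda>\<omega>. \<bar>H u (Z \<omega>)\<bar>)))
    \<le> (expectation (\<lambda>\<omega>. MAX u\<in>U. G u (W \<omega>) + 2 * H u (Z \<omega>))
      + expectation (\<lambda>\<omega>. MAX u\<in>U. G u (W \<omega>) - 2 * H u (Z \<omega>))) / 2"
proof -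
  have W[measurable]: "random_variable S W" and Z[measurable]: "random_variable T Z"
    and prod: "distr M S W \<Otimes>\<^sub>M distr M T Z = distr M (S \<Otimes>\<^sub>M T) (\<lambda>\<omega>. (W \<omega>, Z \<omega>))"
    using ind unfolding indep_var_distribution_eq by auto
  interpret N: prob_space "distr M S W" by (rule prob_space_distr) fact
  interpret P: prob_space "distr M T Z" by (rule prob_space_distr) fact
  interpret NP: pair_prob_space "distr M S W" "distr M T Z" ..
  have HP: "integrable (distr M T Z) (H u)" if "u \<in> U" for u
    using H[OF that] by (simp add: integrable_distr_eq)
  define c where "c u = expectation (\<lambda>\<omega>. \<bar>H u (Z \<omega>)\<bar>)" for u
  have c: "c u = P.expectation (\<lambda>z. \<bar>H u z\<bar>)" for u
    unfolding c_def by (subst integral_distr) auto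
  have intd: "integrable (distr M S W \<Otimes>\<^sub>M distr M T Z) f"
    if "f \<in> borel_measurable (S \<Otimes>\<^sub>M T)" "integrable M (\<lambda>\<omega>. f (W \<omega>, Z \<omega>))" for f :: "_ \<Rightarrow> real"
    unfolding prod using that by (subst integrable_distr_eq) auto
  have fub: "expectation (\<lambda>\<omega>. f (W \<omega>, Z \<omega>)) = N.expectation (\<lambda>w. P.expectation (\<lambda>z. f (w, z)))"
    if "f \<in> borel_measurable (S \<Otimes>\<^sub>M T)" "integrable M (\<lambda>\<omega>. f (W \<omega>, Z \<omega>))" for f :: "_ \<Rightarrow> real"
  proof -
    have "N.expectation (\<lambda>w. P.expectation (\<lambda>z. f (w, z)))
        = integral\<^sup>L (distr M (S \<Otimes>\<^sub>M T) (\<lambda>\<omega>. (W \<omega>, Z \<omega>))) f"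
      using NP.integral_fst'[OF intd[OF that]] prod by simp
    also have "\<dots> = expectation (\<lambda>\<omega>. f (W \<omega>, Z \<omega>))"
      using that(1) by (subst integral_distr) auto
    finally show ?thesis by simp
  qed
  define f0 where "f0 = (\<lambda>(w, z). MAX u\<in>U. G u w + (\<bar>H u z\<bar> - c u))"
  define f1 where "f1 = (\<lambda>(w, z). MAX u\<in>U. G u w + 2 * H u z)"
  define f2 where "f2 = (\<lambda>(w, z). MAX u\<in>U. G u w - 2 * H u z)"
  have meas: "f0 \<in> borel_measurable (S \<Otimes>\<^sub>M T)" "f1 \<in> borel_measurable (S \<Otimes>\<^sub>M T)"
    "f2 \<in> borel_measurable (S \<Otimes>\<^sub>M T)"
    unfolding f0_def f1_def f2_def using U(1) by measurable
  have int: "integrable M (\<lambda>\<omega>. f0 (W \<omega>, Z \<omega>))" "integrable M (\<lambda>\<omega>. f1 (W \<omega>, Z \<omega>))"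
    "integrable M (\<lambda>\<omega>. f2 (W \<omega>, Z \<omega>))"
    unfolding f0_def f1_def f2_def using U G H by (auto intro!: integrable_MAX)
  note intN = NP.integrable_fst'[OF intd[OF meas(1) int(1)]]
    NP.integrable_fst'[OF intd[OF meas(2) int(2)]] NP.integrable_fst'[OF intd[OF meas(3) int(3)]]
  have "expectation (\<lambda>\<omega>. f0 (W \<omega>, Z \<omega>)) = N.expectation (\<lambda>w. P.expectation (\<lambda>z. f0 (w, z)))"
    by (rule fub[OF meas(1) int(1)])
  also have "\<dots> \<le> N.expectation (\<lambda>w. (P.expectation (\<lambda>z. f1 (w, z)) + P.expectation (\<lambda>z. f2 (w, z))) / 2)"
  proof (rule integral_mono)
    show "P.expectation (\<lambda>z. f0 (w, z))
        \<le> (P.expectation (\<lambda>z. f1 (w, z)) + P.expectation (\<lambda>z. f2 (w, z))) / 2" for w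
      using P.expectation_MAX_centred_abs_le[where g = "\<lambda>u. G u w" and H = H, OF U HP]
      by (simp add: f0_def f1_def f2_def c)
  qed (use intN in auto)
  also have "\<dots> = (expectation (\<lambda>\<omega>. f1 (W \<omega>, Z \<omega>)) + expectation (\<lambda>\<omega>. f2 (W \<omega>, Z \<omega>))) / 2"
    using intN by (simp add: fub[OF meas(2) int(2)] fub[OF meas(3) int(3)])
  finally show ?thesis
    by (simp add: f0_def f1_def f2_def c_def)
qed

text \<open>\<open>J\<close> is the set of rows already made linear, and the induction adds one row
  to it at a time. The signs \<open>s\<close> are deterministic: they depend neither on the outcome
  nor on \<open>u\<close>, so for \<open>J = I\<close> they remain fixed when the expectation of a
  column sum is estimated.\<close>

lemma (in prob_space) ex_signs_expectation_MAX_centred_abs_le: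
  fixes Y :: "'i \<Rightarrow> 'k \<Rightarrow> 'a \<Rightarrow> real" and U :: "('k \<Rightarrow> real) set"
  assumes U: "finite U" "U \<noteq> {}" and fin: "finite I" "finite K"
    and ind: "indep_vars (\<lambda>_. borel) (\<lambda>(j, k). Y j k) (I \<times> K)"
    and int: "\<And>j k. j \<in> I \<Longrightarrow> k \<in> K \<Longrightarrow> integrable M (Y j k)"
    and J: "J \<subseteq> I"
  defines "L \<equiv> \<lambda>j u \<omega>. \<Sum>k\<in>K. u k * Y j k \<omega>"
  shows "\<exists>s. (\<forall>j. s j \<in> {1, -1}) \<and>
    expectation (\<lambda>\<omega>. MAX u\<in>U. \<Sum>j\<in>I. \<bar>L j u \<omega>\<bar> - expectation (\<lambda>\<omega>. \<bar>L j u \<omega>\<bar>))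
    \<le> expectation (\<lambda>\<omega>. MAX u\<in>U. (\<Sum>j\<in>I - J. \<bar>L j u \<omega>\<bar> - expectation (\<lambda>\<omega>. \<bar>L j u \<omega>\<bar>))
        + 2 * (\<Sum>j\<in>J. s j * L j u \<omega>))"
  using finite_subset[OF J fin(1)] J
proof (induction J rule: finite_induct)
  case empty
  show ?case
    by (intro exI[of _ "\<lambda>_. 1"]) simp
next
  case (insert i J)
  then have i: "i \<in> I" "i \<notin> J" "J \<subseteq> I" "finite J"
    by auto
  define c where "c j u = expectation (\<lambda>\<omega>. \<bar>L j u \<omega>\<bar>)" for j u
  from insert obtain s :: "'i \<Rightarrow> real" where s: "\<And>j. s j \<in> {1, -1}" and
    IH: "expectation (\<lambda>\<omega>. MAX u\<in>U. \<Sum>j\<in>I. \<bar>L j u \<omega>\<bar> - c j u)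
      \<le> expectation (\<lambda>\<omega>. MAX u\<in>U. (\<Sum>j\<in>I - J. \<bar>L j u \<omega>\<bar> - c j u) + 2 * (\<Sum>j\<in>J. s j * L j u \<omega>))"
    by (auto simp: c_def)
  have intL: "integrable M (L j u)" if "j \<in> I" for j u
    unfolding L_def using int that by auto
  \<comment> \<open>\<open>W\<close> collects the entries outside row \<open>i\<close> and
    \<open>Z\<close> those of row \<open>i\<close>. The index blocks are disjoint, so the two are
    independent; \<open>G\<close> and \<open>H\<close> rewrite the parts of the sum as functions of
    them.\<close>
  define A where "A = (I - {i}) \<times> K"
  define B where "B = {i} \<times> K"
  define W where "W = (\<lambda>\<omega>. \<lambda>p\<in>A. (\<lambda>(j, k). Y j k) p \<omega>)"
  define Z where "Z = (\<lambda>\<omega>. \<lambda>p\<in>B. (\<lambda>(j, k). Y j k) p \<omega>)"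
  have indWZ: "indep_var (PiM A (\<lambda>_. borel)) W (PiM B (\<lambda>_. borel)) Z"
    unfolding W_def Z_def by (rule indep_var_restrict[OF ind]) (use i in \<open>auto simp: A_def B_def\<close>)
  define G where "G u w = (\<Sum>j\<in>I - insert i J. \<bar>\<Sum>k\<in>K. u k * w (j, k)\<bar> - c j u)
    + 2 * (\<Sum>j\<in>J. s j * (\<Sum>k\<in>K. u k * w (j, k)))" for u :: "'k \<Rightarrow> real" and w
  define H where "H u z = (\<Sum>k\<in>K. u k * z (i, k))" for u :: "'k \<Rightarrow> real" and z
  have GW: "G u (W \<omega>) = (\<Sum>j\<in>I - insert i J. \<bar>L j u \<omega>\<bar> - c j u) + 2 * (\<Sum>j\<in>J. s j * L j u \<omega>)" for u \<omega>
  proof -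
    have "(\<Sum>k\<in>K. u k * W \<omega> (j, k)) = L j u \<omega>" if "j \<in> I" "j \<noteq> i" for j
      using that unfolding W_def L_def A_def by (intro sum.cong) auto
    then show ?thesis
      using i unfolding G_def by (intro arg_cong2[where f="(+)"] arg_cong2[where f="(*)"] sum.cong) auto
  qed
  have HZ: "H u (Z \<omega>) = L i u \<omega>" for u \<omega>
    unfolding H_def Z_def L_def B_def by (intro sum.cong) auto
  have comp: "(\<lambda>w. w (j, k)) \<in> borel_measurable (PiM A (\<lambda>_. borel :: real measure))"
    if "j \<in> I" "j \<noteq> i" "k \<in> K" for j k
    using that by (intro measurable_component_singleton) (auto simp: A_def)
  have Gm: "G u \<in> borel_measurable (PiM A (\<lambda>_. borel))" for u
    unfolding G_def
    by (intro borel_measurable_add borel_measurable_sum borel_measurable_diff borel_measurable_abs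
        borel_measurable_times borel_measurable_const comp) (use i in auto)
  have Hm: "H u \<in> borel_measurable (PiM B (\<lambda>_. borel))" for u
    unfolding H_def
    by (intro borel_measurable_sum borel_measurable_times borel_measurable_const
        measurable_component_singleton) (auto simp: B_def)
  have step: "expectation (\<lambda>\<omega>. MAX u\<in>U. G u (W \<omega>) + (\<bar>H u (Z \<omega>)\<bar> - expectation (\<lambda>\<omega>. \<bar>H u (Z \<omega>)\<bar>)))
    \<le> (expectation (\<lambda>\<omega>. MAX u\<in>U. G u (W \<omega>) + 2 * H u (Z \<omega>))
      + expectation (\<lambda>\<omega>. MAX u\<in>U. G u (W \<omega>) - 2 * H u (Z \<omega>))) / 2"
  proof (rule expectation_MAX_centred_abs_le_indep[OF U indWZ Gm Hm])
    show "integrable M (\<lambda>\<omega>. G u (W \<omega>))" for u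
      unfolding GW using intL i(3)
      by (intro Bochner_Integration.integrable_add Bochner_Integration.integrable_sum
          Bochner_Integration.integrable_diff integrable_mult_right integrable_abs) auto
    show "integrable M (\<lambda>\<omega>. H u (Z \<omega>))" for u
      unfolding HZ using intL i by auto
  qed
  have eq: "I - J = insert i (I - insert i J)"
    using i by auto
  have sum_eq: "(\<Sum>j\<in>I - J. \<bar>L j u \<omega>\<bar> - c j u) = (\<bar>L i u \<omega>\<bar> - c i u) + (\<Sum>j\<in>I - insert i J. \<bar>L j u \<omega>\<bar> - c j u)" for u \<omega>
    unfolding eq by (subst sum.insert) (use fin in auto)
  have "expectation (\<lambda>\<omega>. MAX u\<in>U. G u (W \<omega>) + (\<bar>H u (Z \<omega>)\<bar> - expectation (\<lambda>\<omega>. \<bar>H u (Z \<omega>)\<bar>)))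
    = expectation (\<lambda>\<omega>. MAX u\<in>U. (\<Sum>j\<in>I - J. \<bar>L j u \<omega>\<bar> - c j u) + 2 * (\<Sum>j\<in>J. s j * L j u \<omega>))"
    by (simp add: GW HZ sum_eq add_ac flip: c_def)
  with IH step have le: "expectation (\<lambda>\<omega>. MAX u\<in>U. \<Sum>j\<in>I. \<bar>L j u \<omega>\<bar> - c j u)
    \<le> (expectation (\<lambda>\<omega>. MAX u\<in>U. G u (W \<omega>) + 2 * H u (Z \<omega>))
      + expectation (\<lambda>\<omega>. MAX u\<in>U. G u (W \<omega>) - 2 * H u (Z \<omega>))) / 2"
    by simp
  \<comment> \<open>Since \<open>i\<close> is not in \<open>J\<close>, setting the sign of row
    \<open>i\<close> to \<open>t\<close> leaves the signs chosen earlier intact.\<close>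
  have upd: "(\<Sum>j\<in>insert i J. (s(i := t)) j * L j u \<omega>) = t * L i u \<omega> + (\<Sum>j\<in>J. s j * L j u \<omega>)" for t u \<omega>
    using i by (subst sum.insert) (auto intro!: sum.cong)
  have ends: "expectation (\<lambda>\<omega>. MAX u\<in>U. (\<Sum>j\<in>I - insert i J. \<bar>L j u \<omega>\<bar> - c j u)
      + 2 * (\<Sum>j\<in>insert i J. (s(i := t)) j * L j u \<omega>))
    = expectation (\<lambda>\<omega>. MAX u\<in>U. G u (W \<omega>) + 2 * (t * H u (Z \<omega>)))" for t
    unfolding upd GW HZ by (simp add: algebra_simps)
  \<comment> \<open>A number below the average of two values is below one of them; that one
    determines the sign of row \<open>i\<close>.\<close>
  have "\<exists>t\<in>{1, -1}. expectation (\<lambda>\<omega>. MAX u\<in>U. \<Sum>j\<in>I. \<bar>L j u \<omega>\<bar> - c j u)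
    \<le> expectation (\<lambda>\<omega>. MAX u\<in>U. G u (W \<omega>) + 2 * (t * H u (Z \<omega>)))"
    using le by (auto simp: field_simps)
  then obtain t where t: "t \<in> {1, -1}" "expectation (\<lambda>\<omega>. MAX u\<in>U. \<Sum>j\<in>I. \<bar>L j u \<omega>\<bar> - c j u)
    \<le> expectation (\<lambda>\<omega>. MAX u\<in>U. G u (W \<omega>) + 2 * (t * H u (Z \<omega>)))"
    by blast
  show ?case
    unfolding c_def[symmetric]
  proof (intro exI[of _ "s(i := t)"] conjI)
    show "\<forall>j. (s(i := t)) j \<in> {1, -1}"
      using t(1) s by simp
  qed (simp only: ends t(2))
qed

section \<open>Second-moment bounds for signed sums\<close>

lemma (in prob_space) expectation_abs_le_sqrt:
  fixes X :: "'a \<Rightarrow> real"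
  assumes "integrable M X" "integrable M (\<lambda>\<omega>. (X \<omega>)\<^sup>2)"
  shows "expectation (\<lambda>\<omega>. \<bar>X \<omega>\<bar>) \<le> sqrt (expectation (\<lambda>\<omega>. (X \<omega>)\<^sup>2))"
proof (rule real_le_rsqrt)
  show "(expectation (\<lambda>\<omega>. \<bar>X \<omega>\<bar>))\<^sup>2 \<le> expectation (\<lambda>\<omega>. (X \<omega>)\<^sup>2)"
    using variance_positive[of "\<lambda>\<omega>. \<bar>X \<omega>\<bar>"] variance_eq[of "\<lambda>\<omega>. \<bar>X \<omega>\<bar>"] assms by simp
qed

text \<open>Independent centred variables are orthogonal, so only the diagonal of the expanded
  square survives, and there the signs square to 1. The bound is therefore the same for all choices
  of signs; it serves the rows with signs \<open>u\<close> and the columns with signs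
  \<open>s\<close>.\<close>

lemma (in prob_space) expectation_abs_sum_indep_le:
  fixes Y :: "'i \<Rightarrow> 'a \<Rightarrow> real" and s :: "'i \<Rightarrow> real"
  assumes fin: "finite I" and ind: "indep_vars (\<lambda>_. borel) Y I"
    and int: "\<And>i. i \<in> I \<Longrightarrow> integrable M (Y i)"
    and zero: "\<And>i. i \<in> I \<Longrightarrow> expectation (Y i) = 0"
    and sq: "\<And>i. i \<in> I \<Longrightarrow> integrable M (\<lambda>\<omega>. (Y i \<omega>)\<^sup>2)"
    and s: "\<And>i. i \<in> I \<Longrightarrow> s i \<in> {1, -1}"
  shows "expectation (\<lambda>\<omega>. \<bar>\<Sum>i\<in>I. s i * Y i \<omega>\<bar>) \<le> sqrt (\<Sum>i\<in>I. expectation (\<lambda>\<omega>. (Y i \<omega>)\<^sup>2))"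
proof -
  have prod: "integrable M (\<lambda>\<omega>. Y i \<omega> * Y j \<omega>)"
    "expectation (\<lambda>\<omega>. Y i \<omega> * Y j \<omega>) = (if i = j then expectation (\<lambda>\<omega>. (Y i \<omega>)\<^sup>2) else 0)"
    if "i \<in> I" "j \<in> I" for i j
  proof -
    have "integrable M (\<lambda>\<omega>. Y i \<omega> * Y j \<omega>) \<and> expectation (\<lambda>\<omega>. Y i \<omega> * Y j \<omega>) = 0" if "i \<noteq> j"
    proof -
      have "indep_vars (\<lambda>_. borel) Y {i, j}"
        using \<open>i \<in> I\<close> \<open>j \<in> I\<close> by (intro indep_vars_subset[OF ind]) auto
      then show ?thesis
        using indep_vars_integrable[of "{i, j}" Y] indep_vars_lebesgue_integral[of "{i, j}" Y]
          that int zero \<open>i \<in> I\<close> \<open>j \<in> I\<close> by auto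
    qed
    then show "integrable M (\<lambda>\<omega>. Y i \<omega> * Y j \<omega>)"
      "expectation (\<lambda>\<omega>. Y i \<omega> * Y j \<omega>) = (if i = j then expectation (\<lambda>\<omega>. (Y i \<omega>)\<^sup>2) else 0)"
      using sq[OF \<open>i \<in> I\<close>] by (auto simp: power2_eq_square)
  qed
  have expand: "(\<Sum>i\<in>I. s i * Y i \<omega>)\<^sup>2 = (\<Sum>i\<in>I. \<Sum>j\<in>I. s i * s j * (Y i \<omega> * Y j \<omega>))" for \<omega>
    by (simp add: power2_eq_square sum_product mult_ac)
  have ints: "integrable M (\<lambda>\<omega>. (\<Sum>i\<in>I. s i * Y i \<omega>)\<^sup>2)"
    unfolding expand using prod by (intro Bochner_Integration.integrable_sum) auto
  have "expectation (\<lambda>\<omega>. (\<Sum>i\<in>I. s i * Y i \<omega>)\<^sup>2)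
      = (\<Sum>i\<in>I. \<Sum>j\<in>I. s i * s j * expectation (\<lambda>\<omega>. Y i \<omega> * Y j \<omega>))"
    unfolding expand using prod by (simp add: Bochner_Integration.integral_sum)
  also have "\<dots> = (\<Sum>i\<in>I. \<Sum>j\<in>I. if i = j then expectation (\<lambda>\<omega>. (Y i \<omega>)\<^sup>2) else 0)"
  proof (intro sum.cong refl)
    fix i j assume "i \<in> I" "j \<in> I"
    then show "s i * s j * expectation (\<lambda>\<omega>. Y i \<omega> * Y j \<omega>) = (if i = j then expectation (\<lambda>\<omega>. (Y i \<omega>)\<^sup>2) else 0)"
      using prod(2)[of i j] s[of i] by auto
  qed
  also have "\<dots> = (\<Sum>i\<in>I. expectation (\<lambda>\<omega>. (Y i \<omega>)\<^sup>2))"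
    using fin by simp
  finally show ?thesis
    using expectation_abs_le_sqrt[OF _ ints] int by simp
qed

text \<open>Extracts a single row or column from the doubly indexed family. Injectivity makes the
  singleton blocks \<open>{f i}\<close> disjoint, so the result on restrictions to disjoint blocks
  applies.\<close>

lemma (in prob_space) indep_vars_reindex_inj:
  assumes ind: "indep_vars N X I" and f: "inj_on f A" "f ` A \<subseteq> I"
  shows "indep_vars (\<lambda>i. N (f i)) (\<lambda>i. X (f i)) A"
proof -
  have "indep_vars (\<lambda>i. Pi\<^sub>M {f i} N) (\<lambda>i \<omega>. restrict (\<lambda>p. X p \<omega>) {f i}) A"
    by (rule indep_vars_restrict[OF ind]) (use f in \<open>auto simp: disjoint_family_on_def inj_on_def\<close>)
  from indep_vars_compose2[OF this, of "\<lambda>i w. w (f i)" "\<lambda>i. N (f i)"] show ?thesis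
    by simp
qed

section \<open>The bound for the maximum over sign vectors\<close>

text \<open>Centring costs the row term once, while linearization puts the factor 2 on the column
  term only.\<close>

lemma (in prob_space) expectation_MAX_sum_abs_le:
  fixes Y :: "'i \<Rightarrow> 'k \<Rightarrow> 'a \<Rightarrow> real" and U :: "('k \<Rightarrow> real) set"
  assumes U: "finite U" "U \<noteq> {}" and fin: "finite I" "finite K"
    and signs: "\<And>u k. u \<in> U \<Longrightarrow> k \<in> K \<Longrightarrow> u k \<in> {1, -1}"
    and ind: "indep_vars (\<lambda>_. borel) (\<lambda>(j, k). Y j k) (I \<times> K)"
    and int: "\<And>j k. j \<in> I \<Longrightarrow> k \<in> K \<Longrightarrow> integrable M (Y j k)"
    and zero: "\<And>j k. j \<in> I \<Longrightarrow> k \<in> K \<Longrightarrow> expectation (Y j k) = 0"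
    and sq: "\<And>j k. j \<in> I \<Longrightarrow> k \<in> K \<Longrightarrow> integrable M (\<lambda>\<omega>. (Y j k \<omega>)\<^sup>2)"
  defines "v \<equiv> \<lambda>j k. expectation (\<lambda>\<omega>. (Y j k \<omega>)\<^sup>2)"
  shows "expectation (\<lambda>\<omega>. MAX u\<in>U. \<Sum>j\<in>I. \<bar>\<Sum>k\<in>K. u k * Y j k \<omega>\<bar>)
    \<le> 2 * (\<Sum>k\<in>K. sqrt (\<Sum>j\<in>I. v j k)) + (\<Sum>j\<in>I. sqrt (\<Sum>k\<in>K. v j k))"
proof -
  define L where "L j u \<omega> = (\<Sum>k\<in>K. u k * Y j k \<omega>)" for j u \<omega>
  define c where "c j u = expectation (\<lambda>\<omega>. \<bar>L j u \<omega>\<bar>)" for j u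
  let ?R = "\<Sum>j\<in>I. sqrt (\<Sum>k\<in>K. v j k)"
  have intL: "integrable M (L j u)" if "j \<in> I" for j u
    unfolding L_def using int that by auto
  have row: "c j u \<le> sqrt (\<Sum>k\<in>K. v j k)" if "j \<in> I" "u \<in> U" for j u
    unfolding c_def L_def v_def
    using indep_vars_reindex_inj[OF ind, of "Pair j" K] that int zero sq signs fin
    by (intro expectation_abs_sum_indep_le) (auto simp: inj_on_def)
  \<comment> \<open>The bound on the means \<open>c j u\<close> does not depend on \<open>u\<close>,
    so their sum leaves the maximum at the constant cost \<open>?R\<close>.\<close>
  have "expectation (\<lambda>\<omega>. MAX u\<in>U. \<Sum>j\<in>I. \<bar>L j u \<omega>\<bar>)
    \<le> expectation (\<lambda>\<omega>. (MAX u\<in>U. \<Sum>j\<in>I. \<bar>L j u \<omega>\<bar> - c j u) + ?R)"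
  proof (rule integral_mono)
    fix \<omega>
    show "(MAX u\<in>U. \<Sum>j\<in>I. \<bar>L j u \<omega>\<bar>) \<le> (MAX u\<in>U. \<Sum>j\<in>I. \<bar>L j u \<omega>\<bar> - c j u) + ?R"
    proof (rule Max.boundedI)
      fix x assume "x \<in> (\<lambda>u. \<Sum>j\<in>I. \<bar>L j u \<omega>\<bar>) ` U"
      then obtain u where u: "u \<in> U" and x: "x = (\<Sum>j\<in>I. \<bar>L j u \<omega>\<bar>)"
        by auto
      have "(\<Sum>j\<in>I. \<bar>L j u \<omega>\<bar> - c j u) \<le> (MAX u\<in>U. \<Sum>j\<in>I. \<bar>L j u \<omega>\<bar> - c j u)"
        using U u by (intro Max_ge) auto
      moreover have "(\<Sum>j\<in>I. c j u) \<le> ?R"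
        using row u by (intro sum_mono) auto
      ultimately show "x \<le> (MAX u\<in>U. \<Sum>j\<in>I. \<bar>L j u \<omega>\<bar> - c j u) + ?R"
        by (simp add: x sum_subtractf)
    qed (use U in auto)
  qed (use U intL in \<open>auto intro!: integrable_MAX Bochner_Integration.integrable_add Bochner_Integration.integrable_sum\<close>)
  also have "\<dots> = expectation (\<lambda>\<omega>. MAX u\<in>U. \<Sum>j\<in>I. \<bar>L j u \<omega>\<bar> - c j u) + ?R"
    using U intL by (subst Bochner_Integration.integral_add) (auto intro!: integrable_MAX simp: prob_space)
  also have "expectation (\<lambda>\<omega>. MAX u\<in>U. \<Sum>j\<in>I. \<bar>L j u \<omega>\<bar> - c j u)
    \<le> 2 * (\<Sum>k\<in>K. sqrt (\<Sum>j\<in>I. v j k))"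
  proof -
    \<comment> \<open>Here \<open>J = I\<close>: no centred absolute value remains.\<close>
    obtain s :: "'i \<Rightarrow> real" where s: "\<And>j. s j \<in> {1, -1}"
      and le: "expectation (\<lambda>\<omega>. MAX u\<in>U. \<Sum>j\<in>I. \<bar>L j u \<omega>\<bar> - c j u)
        \<le> expectation (\<lambda>\<omega>. MAX u\<in>U. 2 * (\<Sum>j\<in>I. s j * L j u \<omega>))"
      using ex_signs_expectation_MAX_centred_abs_le[OF U fin ind int subset_refl]
      by (auto simp flip: L_def c_def)
    note le
    \<comment> \<open>After exchanging the sums, \<open>u k\<close> multiplies a signed sum of
      column \<open>k\<close> that does not involve \<open>u\<close>. Taking absolute values column
      by column eliminates the maximum.\<close>
    also have "expectation (\<lambda>\<omega>. MAX u\<in>U. 2 * (\<Sum>j\<in>I. s j * L j u \<omega>))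
      \<le> expectation (\<lambda>\<omega>. 2 * (\<Sum>k\<in>K. \<bar>\<Sum>j\<in>I. s j * Y j k \<omega>\<bar>))"
    proof (rule integral_mono)
      fix \<omega>
      have "(\<Sum>j\<in>I. s j * L j u \<omega>) \<le> (\<Sum>k\<in>K. \<bar>\<Sum>j\<in>I. s j * Y j k \<omega>\<bar>)" if "u \<in> U" for u
      proof -
        have "(\<Sum>j\<in>I. s j * L j u \<omega>) = (\<Sum>k\<in>K. u k * (\<Sum>j\<in>I. s j * Y j k \<omega>))"
          unfolding L_def sum_distrib_left by (subst sum.swap) (simp add: mult_ac)
        also have "\<dots> \<le> (\<Sum>k\<in>K. \<bar>\<Sum>j\<in>I. s j * Y j k \<omega>\<bar>)"
          using signs[OF that] by (intro sum_mono) force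
        finally show ?thesis .
      qed
      then show "(MAX u\<in>U. 2 * (\<Sum>j\<in>I. s j * L j u \<omega>)) \<le> 2 * (\<Sum>k\<in>K. \<bar>\<Sum>j\<in>I. s j * Y j k \<omega>\<bar>)"
        using U by (intro Max.boundedI) auto
    qed (use U intL int in \<open>auto intro!: integrable_MAX Bochner_Integration.integrable_sum\<close>)
    also have "\<dots> = 2 * (\<Sum>k\<in>K. expectation (\<lambda>\<omega>. \<bar>\<Sum>j\<in>I. s j * Y j k \<omega>\<bar>))"
      using int by (subst integral_mult_right_zero, subst Bochner_Integration.integral_sum) auto
    also have "\<dots> \<le> 2 * (\<Sum>k\<in>K. sqrt (\<Sum>j\<in>I. v j k))"
    proof (intro mult_left_mono sum_mono)
      fix k assume "k \<in> K"
      then show "expectation (\<lambda>\<omega>. \<bar>\<Sum>j\<in>I. s j * Y j k \<omega>\<bar>) \<le> sqrt (\<Sum>j\<in>I. v j k)"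
        unfolding v_def using indep_vars_reindex_inj[OF ind, of "\<lambda>j. (j, k)" I] int zero sq s fin
        by (intro expectation_abs_sum_indep_le) (auto simp: inj_on_def)
    qed simp
    finally show ?thesis .
  qed
  finally show ?thesis
    by (simp add: L_def)
qed

section \<open>From the operator norm to sign vectors, and the final estimate\<close>

text \<open>With the signs \<open>s\<close> of \<open>B *v w\<close> fixed, the 1-norm becomes a
  linear form in \<open>w\<close> with coefficients \<open>d\<close>. On the cube of radius
  \<open>r\<close> such a form is largest at the vertex given by the signs \<open>u\<close> of
  \<open>d\<close>.\<close>

lemma norm_inf_to_1_le_MAX_signs:
  fixes B :: "real ^ 'n ^ 'm"
  shows "norm_inf_to_1 B \<le> (MAX u\<in>UNIV \<rightarrow>\<^sub>E {1, -1}. \<Sum>j\<in>UNIV. \<bar>\<Sum>k\<in>UNIV. u k * B $ j $ k\<bar>)"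
    (is "_ \<le> Max (?f ` ?U)")
proof -
  obtain w :: "real ^ 'n" where w: "w \<noteq> 0" "norm_inf_to_1 B = norm1 (B *v w) / infnorm w"
    using norm_inf_to_1_attained[of B] by metis
  define r where "r = infnorm w"
  have r: "r > 0"
    using w(1) by (simp add: r_def infnorm_pos_lt)
  have wk: "\<bar>w $ k\<bar> \<le> r" for k
    unfolding r_def by (rule component_le_infnorm_cart)
  define s where "s j = (if (B *v w) $ j \<ge> 0 then 1 else - 1 :: real)" for j
  define d where "d k = (\<Sum>j\<in>UNIV. s j * B $ j $ k)" for k
  define u where "u k = (if d k \<ge> 0 then 1 else - 1 :: real)" for k
  have "norm1 (B *v w) = (\<Sum>j\<in>UNIV. s j * (\<Sum>k\<in>UNIV. B $ j $ k * w $ k))"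
    unfolding norm1_def s_def by (intro sum.cong) (auto simp: matrix_vector_mult_def)
  also have "\<dots> = (\<Sum>k\<in>UNIV. d k * w $ k)"
    unfolding d_def sum_distrib_left sum_distrib_right by (subst sum.swap) (simp add: mult_ac)
  also have "\<dots> \<le> (\<Sum>k\<in>UNIV. r * (u k * d k))"
  proof (rule sum_mono)
    fix k
    have "d k * w $ k \<le> \<bar>d k\<bar> * \<bar>w $ k\<bar>"
      by (metis abs_ge_self abs_mult)
    also have "\<dots> \<le> \<bar>d k\<bar> * r"
      using wk by (intro mult_left_mono) auto
    finally show "d k * w $ k \<le> r * (u k * d k)"
      by (auto simp: u_def mult_ac split: if_splits)
  qed
  also have "\<dots> = r * (\<Sum>j\<in>UNIV. s j * (\<Sum>k\<in>UNIV. u k * B $ j $ k))"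
    unfolding d_def sum_distrib_left by (subst sum.swap) (simp add: mult_ac)
  also have "\<dots> \<le> r * ?f u"
    using r by (intro mult_left_mono sum_mono) (auto simp: s_def)
  also have "\<dots> \<le> r * Max (?f ` ?U)"
    using r by (intro mult_left_mono Max_ge imageI) (auto simp: u_def finite_PiE PiE_iff)
  finally show ?thesis
    using r by (simp add: w(2) field_simps flip: r_def)
qed

theorem corollary2:
  fixes M :: "'a measure"
    and A :: "real ^ 'n ^ 'm"
    and X :: "'a \<Rightarrow> real ^ 'n ^ 'm"
  assumes "prob_space M"
    and "prob_space.indep_vars M (\<lambda>_. borel) (\<lambda>(j, k) \<omega>. X \<omega> $ j $ k) (UNIV :: ('m \<times> 'n) set)"
    and "\<And>j k. integrable M (\<lambda>\<omega>. X \<omega> $ j $ k)"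
    and "\<And>j k. integral\<^sup>L M (\<lambda>\<omega>. X \<omega> $ j $ k) = A $ j $ k"
  shows "(\<integral>\<^sup>+\<omega>. ennreal (norm_inf_to_1 (A - X \<omega>)) \<partial>M)
    \<le> 2 * ((\<Sum>k\<in>UNIV. ennreal_sqrt (\<Sum>j\<in>UNIV. ext_variance M (\<lambda>\<omega>. X \<omega> $ j $ k)))
         + (\<Sum>j\<in>UNIV. ennreal_sqrt (\<Sum>k\<in>UNIV. ext_variance M (\<lambda>\<omega>. X \<omega> $ j $ k))))"
\<comment> \<open>One infinite variance makes the term of its row, and so the whole right-hand side,
  infinite. Otherwise all squares are integrable and the estimate takes place in the reals.\<close>
proof (cases "\<exists>j k. ext_variance M (\<lambda>\<omega>. X \<omega> $ j $ k) = \<infinity>")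
  case True
  then obtain j k where "ext_variance M (\<lambda>\<omega>. X \<omega> $ j $ k) = \<infinity>"
    by blast
  then have "(\<Sum>k\<in>UNIV. ext_variance M (\<lambda>\<omega>. X \<omega> $ j $ k)) = \<infinity>"
    by auto
  then have "ennreal_sqrt (\<Sum>k\<in>UNIV. ext_variance M (\<lambda>\<omega>. X \<omega> $ j $ k)) = \<infinity>"
    by (simp add: ennreal_sqrt_def)
  then have top: "(\<Sum>j\<in>UNIV. ennreal_sqrt (\<Sum>k\<in>UNIV. ext_variance M (\<lambda>\<omega>. X \<omega> $ j $ k))) = \<infinity>"
    by auto
  show ?thesis
    unfolding top by (simp add: ennreal_mult_top)
next
  case False
  interpret prob_space M by fact
  define Y where "Y j k \<omega> = A $ j $ k - X \<omega> $ j $ k" for j k \<omega>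
  define v where "v j k = expectation (\<lambda>\<omega>. (Y j k \<omega>)\<^sup>2)" for j k
  let ?U = "(UNIV :: 'n set) \<rightarrow>\<^sub>E {1, - 1 :: real}"
  let ?F = "\<lambda>\<omega>. MAX u\<in>?U. \<Sum>j\<in>UNIV. \<bar>\<Sum>k\<in>UNIV. u k * Y j k \<omega>\<bar>"
  have U: "finite ?U" "?U \<noteq> {}"
    by (auto simp: finite_PiE PiE_eq_empty_iff)
  have ind: "indep_vars (\<lambda>_. borel) (\<lambda>(j, k). Y j k) (UNIV \<times> UNIV)"
    using indep_vars_compose2[OF assms(2), of "\<lambda>(j, k) x. A $ j $ k - x" "\<lambda>_. borel"]
    by (simp add: Y_def[abs_def] case_prod_unfold)
  have int: "integrable M (Y j k)" for j k
    unfolding Y_def using assms(3) by simp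
  have zero: "expectation (Y j k) = 0" for j k
    unfolding Y_def using assms(3,4) by (simp add: prob_space)
  \<comment> \<open>As the mean of each entry is the entry of \<open>A\<close>, its variance is the
    second moment of \<open>Y j k\<close>.\<close>
  have var: "ext_variance M (\<lambda>\<omega>. X \<omega> $ j $ k) = (\<integral>\<^sup>+\<omega>. ennreal ((Y j k \<omega>)\<^sup>2) \<partial>M)" for j k
    unfolding ext_variance_def assms(4) Y_def by (simp add: power2_commute)
  have sq: "integrable M (\<lambda>\<omega>. (Y j k \<omega>)\<^sup>2)" for j k
  proof (rule integrableI_nonneg)
    show "(\<integral>\<^sup>+\<omega>. ennreal ((Y j k \<omega>)\<^sup>2) \<partial>M) < \<infinity>"
      using False var by (auto simp: less_top)
    show "(\<lambda>\<omega>. (Y j k \<omega>)\<^sup>2) \<in> borel_measurable M"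
      using borel_measurable_integrable[OF int] by measurable
  qed simp
  have var': "ext_variance M (\<lambda>\<omega>. X \<omega> $ j $ k) = ennreal (v j k)" for j k
    unfolding var v_def by (rule nn_integral_eq_integral[OF sq]) simp
  have v0: "v j k \<ge> 0" for j k
    unfolding v_def by simp
  have intF: "integrable M ?F"
    using U int by (auto intro!: integrable_MAX)
  have F0: "0 \<le> ?F \<omega>" for \<omega>
    using U by (auto simp: Max_ge_iff intro: sum_nonneg)
  have "(\<integral>\<^sup>+\<omega>. ennreal (norm_inf_to_1 (A - X \<omega>)) \<partial>M) \<le> (\<integral>\<^sup>+\<omega>. ennreal (?F \<omega>) \<partial>M)"
    using norm_inf_to_1_le_MAX_signs[of "A - X _"]
    by (intro nn_integral_mono ennreal_leI) (simp add: Y_def)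
  also have "\<dots> = ennreal (expectation ?F)"
    using intF F0 by (intro nn_integral_eq_integral) auto
  also have "\<dots> \<le> ennreal (2 * (\<Sum>k\<in>UNIV. sqrt (\<Sum>j\<in>UNIV. v j k)) + (\<Sum>j\<in>UNIV. sqrt (\<Sum>k\<in>UNIV. v j k)))"
    unfolding v_def using U ind int zero sq
    by (intro ennreal_leI expectation_MAX_sum_abs_le) (auto simp: PiE_iff)
  \<comment> \<open>The row term is doubled to reach the symmetric form of the claim.\<close>
  also have "\<dots> \<le> ennreal (2 * ((\<Sum>k\<in>UNIV. sqrt (\<Sum>j\<in>UNIV. v j k)) + (\<Sum>j\<in>UNIV. sqrt (\<Sum>k\<in>UNIV. v j k))))"
    using v0 by (intro ennreal_leI) (simp add: sum_nonneg)
  also have "\<dots> = 2 * ((\<Sum>k\<in>UNIV. ennreal_sqrt (\<Sum>j\<in>UNIV. ext_variance M (\<lambda>\<omega>. X \<omega> $ j $ k)))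
         + (\<Sum>j\<in>UNIV. ennreal_sqrt (\<Sum>k\<in>UNIV. ext_variance M (\<lambda>\<omega>. X \<omega> $ j $ k))))"
    using v0 by (simp add: var' ennreal_sqrt_def sum_nonneg ennreal_mult)
  finally show ?thesis .
qed

end
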